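(* Let $\mu\in\mathcal M_+$, $\mu\neq\delta_0$, and let $L\in\mathcal R_0$. If $\mu\big((x,+\infty)\big)\sim L(x)$, then $$x\mapsto\frac{1}{S_\mu(-1/x)}\in K\mathcal R_\infty .$$ Conversely, if $x\mapsto 1/S_\mu(-1/x)$ belongs to $K\mathcal R_\infty$, then $\mu\big((x,+\infty)\big)\sim L(x)$ holds with the slowly varying function $$L(x)=\frac{1}{f_\mu^{\langle-1\rangle}(x)},\qquad\text{where}\quad f_\mu(x):=-\frac{1}{\chi_\mu(-1/x)}=\frac{x-1}{S_\mu(-1/x)} .$$
   Context: $\mathcal M_+$ is the set of Borel probability measures on $[0,+\infty)$. $f(x)\sim g(x)$ means $f(x)/g(x)\to1$ as $x\to+\infty$. $\mathcal R_0$ is the class of slowly varying functions: (positive, measurable) $f$ on a neighborhood of $+\infty$ with $f(\lambda x)/f(x)\to1$ as $x\to+\infty$ for every $\lambda>0$. $f^{\langle-1\rangle}$ denotes the compositional inverse of $f$. $K\mathcal R_\infty$ is the class of measurable (positive) functions $f$ on a neighborhood of $+\infty$ such that for every $d\in\mathbb R$, $\liminf_{x\to+\infty}\inf_{\lambda\ge1}\frac{f(\lambda x)}{\lambda^d f(x)}\ge1$. For $\mu\in\mathcal M_+$, $\mu\ne\delta_0$, put $\delta=\mu(\{0\})<1$ and $\psi_\mu(z)=\int_{[0,+\infty)}\frac{zt}{1-zt}\,\mu(\mathrm dt)$, $z<0$. The map $\psi_\mu:(-\infty,0)\to(\delta-1,0)$ is invertible with inverse $\chi_\mu$, and the $S$-transform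 is $S_\mu(z)=\frac{z+1}{z}\chi_\mu(z)$, $z\in(\delta-1,0)$; so $S_\mu(-1/x)$ and $f_\mu(x)$ are defined for $x>(1-\delta)^{-1}$. *)

theory Defs
  imports "HOL-Probability.Probability"
begin

text \<open>
  The set \<open>M\<^sub>+\<close> of Borel probability measures on \<open>[0,\<infinity>)\<close>, each identified with the
  Borel probability measure on the real line that gives mass 1 to \<open>[0,\<infinity>)\<close>.
\<close>
definition M_plus :: "real measure set" where
  "M_plus = {\<mu>. real_distribution \<mu> \<and> measure \<mu> {0..} = 1}"

text \<open>
  Functions defined on a neighbourhood of \<open>+\<infinity>\<close> are represented by total functions, of which
  only the values on some \<open>(a,\<infinity>)\<close> matter.
\<close>
definition pos_measurable_near_infinity :: "(real \<Rightarrow> real) \<Rightarrow> bool" where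
  "pos_measurable_near_infinity f \<longleftrightarrow>
     (\<exists>a. f \<in> borel_measurable (restrict_space borel {a<..}) \<and> (\<forall>x>a. f x > 0))"

definition slowly_varying :: "(real \<Rightarrow> real) set" where
  "slowly_varying = {f. pos_measurable_near_infinity f \<and>
     (\<forall>l>0. ((\<lambda>x. f (l * x) / f x) \<longlongrightarrow> 1) at_top)}"

text \<open>
  The class \<open>K R\<^sub>\<infinity>\<close>. The infimum and the lower limit are taken in the extended reals, so that
  both always exist.
\<close>
definition KR_infinity :: "(real \<Rightarrow> real) set" where
  "KR_infinity = {f. pos_measurable_near_infinity f \<and>
     (\<forall>d::real. Liminf at_top (\<lambda>x. INF l\<in>{1..}. ereal (f (l * x) / (l powr d * f x))) \<ge> 1)}"

definition psi :: "real measure \<Rightarrow> real \<Rightarrow> real" where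
  "psi \<mu> z = (LINT t:{0..}|\<mu>. z * t / (1 - z * t))"

text \<open>
  For \<open>\<mu> \<in> M\<^sub>+\<close> other than the point mass at 0, \<open>psi \<mu>\<close> maps \<open>(-\<infinity>,0)\<close> bijectively onto
  \<open>(\<mu>{0} - 1, 0)\<close>; the values of \<open>chi \<mu>\<close> and \<open>S_transform \<mu>\<close> are meaningful on the latter
  interval only.
\<close>
definition chi :: "real measure \<Rightarrow> real \<Rightarrow> real" where
  "chi \<mu> = the_inv_into {..<0} (psi \<mu>)"

definition S_transform :: "real measure \<Rightarrow> real \<Rightarrow> real" where
  "S_transform \<mu> z = (z + 1) / z * chi \<mu> z"

definition f_fun :: "real measure \<Rightarrow> real \<Rightarrow> real" where
  "f_fun \<mu> x = - 1 / chi \<mu> (- 1 / x)"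

text \<open>
  The compositional inverse of \<open>f_fun \<mu>\<close>, which maps its domain \<open>(1/(1 - \<mu>{0}), \<infinity>)\<close>
  bijectively onto \<open>(0,\<infinity>)\<close>.
\<close>
definition f_inv :: "real measure \<Rightarrow> real \<Rightarrow> real" where
  "f_inv \<mu> = the_inv_into {1 / (1 - measure \<mu> {0})<..} (f_fun \<mu>)"

end

theory Submission
  imports Defs "HOL-Real_Asymp.Real_Asymp"
begin

text \<open>
  All objects of the theorem are read off one decreasing function of \<open>s > 0\<close>,
  \<open>\<phi>(s) = \<integral> t / (s + t) d\<mu>(t) = - psi \<mu> (- 1 / s)\<close>,
  which maps \<open>(0,\<infinity>)\<close> bijectively onto \<open>(0, 1 - \<mu>{0})\<close>. The function \<open>f_fun \<mu>\<close> is the inverse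
  of \<open>1 / \<phi>\<close>, so \<open>1 / f_inv \<mu> = \<phi>\<close>, and \<open>1 / S_transform \<mu> (- 1 / x) = f_fun \<mu> x / (x - 1)\<close>.
  The theorem then splits into two equivalences.

  First, the tail \<open>T(x) = \<mu>(x,\<infinity>)\<close> varies slowly if and only if \<open>\<phi>\<close> does, and then \<open>T \<sim> \<phi>\<close>.
  This rests on the two-sided estimate (\<open>tail_le_phi\<close>, \<open>phi_le_tail_plus\<close>)
  \<open>T(s / \<epsilon>) / (1 + \<epsilon>) \<le> \<phi>(s) \<le> T(\<epsilon> s) + 2 \<epsilon> \<phi>(\<epsilon> s)\<close>
  for \<open>0 < \<epsilon> \<le> 1\<close>. If \<open>\<phi>\<close> varies slowly, dividing by \<open>\<phi>\<close> and letting \<open>\<epsilon>\<close> tend to 0 gives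
  \<open>T \<sim> \<phi>\<close>. If \<open>T\<close> varies slowly, the same argument works once \<open>\<phi> = O(T)\<close> is known, which
  follows by iterating the upper estimate with \<open>\<epsilon> = 1 / 4\<close> (\<open>phi_le_const_tail\<close>); and \<open>\<phi>\<close>, being
  asymptotic to \<open>T\<close>, varies slowly too.

  Secondly, \<open>\<phi>\<close> varies slowly if and only if \<open>x \<mapsto> f_fun \<mu> x / (x - 1)\<close> lies in \<open>K R\<^sub>\<infinity>\<close>: an
  inverse of a slowly varying function outgrows every power. Slow variation gives, by iteration, a
  Potter bound \<open>\<phi>(s) \<le> l \<phi>(l\<^sup>D s / a)\<close>, uniformly in \<open>l \<ge> 1\<close> and with \<open>a\<close> as close to 1 as desired
  (\<open>phi_potter\<close>); read at \<open>s = f_fun \<mu> x\<close> it says \<open>f_fun \<mu> (l x) \<ge> l\<^sup>D f_fun \<mu> x / a\<close>. Conversely,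
  the growth condition with a large exponent yields \<open>f_fun \<mu> (b x) \<ge> a f_fun \<mu> x\<close> for any
  \<open>a, b > 1\<close> and large \<open>x\<close>, that is, \<open>\<phi>(s) \<le> b \<phi>(a s)\<close> for large \<open>s\<close>.
\<close>

section \<open>Slow variation of monotone functions\<close>

text \<open>
  The limit condition in slow variation; by itself it passes between asymptotically equivalent
  functions.
\<close>
definition varies_slowly :: "(real \<Rightarrow> real) \<Rightarrow> bool" where
  "varies_slowly F \<longleftrightarrow> (\<forall>l>0. ((\<lambda>x. F (l * x) / F x) \<longlongrightarrow> 1) at_top)"

lemma filterlim_mult_at_top:
  fixes l :: real
  assumes "l > 0"
  shows "filterlim (\<lambda>x. l * x) at_top at_top"
  using filterlim_tendsto_pos_mult_at_top[OF tendsto_const assms filterlim_ident] .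

lemma varies_slowlyD: "varies_slowly F \<Longrightarrow> l > 0 \<Longrightarrow> ((\<lambda>x. F (l * x) / F x) \<longlongrightarrow> 1) at_top"
  by (simp add: varies_slowly_def)

lemma varies_slowly_asymp:
  assumes G: "varies_slowly G" and FG: "((\<lambda>x. F x / G x) \<longlongrightarrow> 1) at_top"
  shows "varies_slowly F"
  unfolding varies_slowly_def
proof (intro allI impI)
  fix l :: real assume l: "l > 0"
  have "((\<lambda>x. F (l * x) / G (l * x)) \<longlongrightarrow> 1) at_top"
    using filterlim_compose[OF FG filterlim_mult_at_top[OF l]] .
  moreover have "((\<lambda>x. G (l * x) / G x) \<longlongrightarrow> 1) at_top"
    using G l unfolding varies_slowly_def by blast
  ultimately have lim: "((\<lambda>x. (F (l * x) / G (l * x)) * (G (l * x) / G x) / (F x / G x)) \<longlongrightarrow> 1 * 1 / 1) at_top"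
    by (intro tendsto_intros FG) auto
  have "\<forall>\<^sub>F x in at_top. F x / G x > 0"
    using order_tendstoD(1)[OF FG] by simp
  then have nz: "\<forall>\<^sub>F x in at_top. G x \<noteq> 0"
    by eventually_elim auto
  have "\<forall>\<^sub>F x in at_top. G (l * x) \<noteq> 0"
    using filterlim_iff[THEN iffD1, OF filterlim_mult_at_top[OF l], rule_format, OF nz] .
  with nz have "\<forall>\<^sub>F x in at_top.
      (F (l * x) / G (l * x)) * (G (l * x) / G x) / (F x / G x) = F (l * x) / F x"
    by eventually_elim simp
  from Lim_transform_eventually[OF lim this]
  show "((\<lambda>x. F (l * x) / F x) \<longlongrightarrow> 1) at_top" by simp
qed

text \<open>
  For a decreasing function the ratio \<open>F(a s) / F(s)\<close> with \<open>a > 1\<close> is at most 1, so a one-sided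
  estimate suffices; dilations by \<open>l < 1\<close> are inverses of dilations by \<open>1 / l\<close>.
\<close>
lemma varies_slowly_antimonoI:
  assumes anti: "\<And>s s'. 0 < s \<Longrightarrow> s \<le> s' \<Longrightarrow> F s' \<le> F s"
    and pos: "\<And>s. 0 < s \<Longrightarrow> F s > 0"
    and bound: "\<And>a b. a > 1 \<Longrightarrow> b > 1 \<Longrightarrow> \<forall>\<^sub>F s in at_top. F s \<le> b * F (a * s)"
  shows "varies_slowly F"
proof -
  have gt: "((\<lambda>x. F (a * x) / F x) \<longlongrightarrow> 1) at_top" if a: "a > 1" for a
  proof (rule order_tendstoI)
    fix u :: real assume u: "u < 1"
    define b where "b = 2 / (1 + max u 0)"
    have b: "b > 1" "1 / b > u" using u by (auto simp: b_def max_def field_simps)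
    show "\<forall>\<^sub>F x in at_top. u < F (a * x) / F x"
      using bound[OF a b(1)] eventually_gt_at_top[of 0]
    proof eventually_elim
      case (elim x)
      then have "1 / b \<le> F (a * x) / F x" using pos[of x] b(1) by (simp add: field_simps)
      with b(2) show ?case by linarith
    qed
  next
    fix u :: real assume u: "1 < u"
    show "\<forall>\<^sub>F x in at_top. F (a * x) / F x < u"
      using eventually_gt_at_top[of 0]
    proof eventually_elim
      case (elim x)
      then have "F (a * x) \<le> F x" using anti[of x "a * x"] a by simp
      then have "F (a * x) / F x \<le> 1" using pos[OF elim] by simp
      with u show ?case by linarith
    qed
  qed
  show ?thesis unfolding varies_slowly_def
  proof (intro allI impI)
    fix l :: real assume l: "l > 0"
    consider "l > 1" | "l = 1" | "l < 1" by linarith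
    then show "((\<lambda>x. F (l * x) / F x) \<longlongrightarrow> 1) at_top"
    proof cases
      case 1 then show ?thesis by (rule gt)
    next
      case 2
      have "\<forall>\<^sub>F x in at_top. F (l * x) / F x = 1"
        using eventually_gt_at_top[of 0]
        by eventually_elim (use pos 2 in force)
      then show ?thesis by (rule tendsto_eventually)
    next
      case 3
      have "((\<lambda>x. F (1 / l * (l * x)) / F (l * x)) \<longlongrightarrow> 1) at_top"
        using filterlim_compose[OF gt[of "1 / l"] filterlim_mult_at_top[OF l]] l 3 by simp
      from tendsto_divide[OF tendsto_const[of 1] this] l show ?thesis by simp
    qed
  qed
qed

text \<open>
  Induction over the geometric scale: every \<open>s \<ge> s0\<close> is reached from the fundamental interval
  \<open>[s0, a s0]\<close> by finitely many multiplications by \<open>a\<close>.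
\<close>
lemma scaling_induct:
  fixes a s0 :: real
  assumes "a > 1" "s0 > 0"
    and base: "\<And>s. s0 \<le> s \<Longrightarrow> s \<le> a * s0 \<Longrightarrow> P s"
    and step: "\<And>s. s0 \<le> s \<Longrightarrow> P s \<Longrightarrow> P (a * s)"
    and "s0 \<le> s"
  shows "P s"
proof -
  have "\<forall>s. s0 \<le> s \<and> s \<le> a ^ n * s0 \<longrightarrow> P s" for n
  proof (induction n)
    case 0 then show ?case using base assms(1,2) by (auto intro: order_trans)
  next
    case (Suc n)
    show ?case
    proof (intro allI impI, elim conjE)
      fix s assume s: "s0 \<le> s" "s \<le> a ^ Suc n * s0"
      show "P s"
      proof (cases "s \<le> a * s0")
        case False
        then have "s0 \<le> s / a" "s / a \<le> a ^ n * s0"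
          using s assms(1) by (auto simp: field_simps)
        with Suc.IH step[of "s / a"] assms(1) show ?thesis by auto
      qed (use base s in blast)
    qed
  qed
  moreover obtain n where "s / s0 < a ^ n" using real_arch_pow[OF assms(1)] by blast
  then have "s \<le> a ^ n * s0" using assms(2) by (simp add: field_simps)
  ultimately show ?thesis using assms(5) by blast
qed


section \<open>The Stieltjes-type transform of a law on the half-line\<close>

locale half_line_law = real_distribution M for M :: "real measure" +
  assumes nonneg: "AE t in M. 0 \<le> t"
    and not_all_at_0: "prob {0} < 1"
begin

text \<open>
  As \<open>t / (s + t) = 1 - s / (s + t)\<close>, this is \<open>1 - s G(s)\<close> for the Stieltjes transform
  \<open>G(s) = \<integral> 1 / (s + t) dM(t)\<close>.
\<close>
definition phi :: "real \<Rightarrow> real" where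
  "phi s = expectation (\<lambda>t. t / (s + t))"

abbreviation tail :: "real \<Rightarrow> real" where
  "tail x \<equiv> prob {x<..}"

lemma psi_eq:
  assumes "s > 0"
  shows "psi M (- 1 / s) = - phi s"
proof -
  have "psi M (- 1 / s) = (\<integral>t. - (t / (s + t)) \<partial>M)"
    unfolding psi_def set_lebesgue_integral_def
  proof (rule integral_cong_AE)
    show "AE t in M. indicator {0..} t *\<^sub>R (- 1 / s * t / (1 - - 1 / s * t)) = - (t / (s + t))"
      using nonneg by eventually_elim (use assms in \<open>auto simp: divide_simps\<close>)
  qed auto
  also have "\<dots> = - phi s" by (simp add: phi_def)
  finally show ?thesis .
qed

lemma kernel_bounds:
  fixes s t :: real
  assumes "s > 0" "t \<ge> 0"
  shows "0 \<le> t / (s + t)" "t / (s + t) \<le> 1"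
  using assms by auto

lemma kernel_integrable [simp]:
  assumes "s > 0"
  shows "integrable M (\<lambda>t. t / (s + t))"
proof (rule integrable_const_bound)
  show "AE t in M. norm (t / (s + t)) \<le> 1"
    using nonneg by eventually_elim (use assms in \<open>auto simp: divide_simps\<close>)
qed auto

lemma prob_open_half_line: "prob {0<..} = 1 - prob {0}"
proof -
  have "prob {0..} = 1"
    using nonneg by (subst prob_eq_1) auto
  moreover have "{0..} = {0} \<union> {0::real<..}" by auto
  then have "prob {0..} = prob {0} + prob {0<..}"
    by (simp only:) (rule finite_measure_Union; auto)
  ultimately show ?thesis by simp
qed

text \<open>
  Strictness comes from the mass that the law puts on the open half-line. Positivity, strict
  monotonicity and the strict upper bound of the transform are all instances.
\<close>
lemma expectation_less:
  fixes X Y :: "real \<Rightarrow> real"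
  assumes "integrable M X" "integrable M Y"
    and "X 0 \<le> Y 0" and "\<And>t. t > 0 \<Longrightarrow> X t < Y t"
  shows "expectation X < expectation Y"
proof (rule integral_less_AE[OF assms(1,2), where A = "{0<..}"])
  show "emeasure M {0<..} \<noteq> 0"
    using prob_open_half_line not_all_at_0 by (simp add: emeasure_eq_measure)
  show "AE t in M. t \<in> {0<..} \<longrightarrow> X t \<noteq> Y t"
    using assms(4) by (intro AE_I2) fastforce
  show "AE t in M. X t \<le> Y t"
    using nonneg by eventually_elim (use assms(3,4) in \<open>auto simp: le_less\<close>)
qed auto

lemma phi_pos:
  assumes "s > 0"
  shows "phi s > 0"
  using expectation_less[of "\<lambda>_. 0" "\<lambda>t. t / (s + t)"] assms by (simp add: phi_def)

lemma phi_strict_antimono: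
  assumes "0 < s" "s < s'"
  shows "phi s' < phi s"
  unfolding phi_def
  by (rule expectation_less) (use assms in \<open>auto intro!: divide_strict_left_mono\<close>)

lemma phi_antimono: "0 < s \<Longrightarrow> s \<le> s' \<Longrightarrow> phi s' \<le> phi s"
  using phi_strict_antimono[of s s'] by (cases "s = s'") auto

lemma phi_le_iff: "0 < s \<Longrightarrow> 0 < s' \<Longrightarrow> phi s \<le> phi s' \<longleftrightarrow> s' \<le> s"
  using phi_antimono[of s' s] phi_strict_antimono[of s s'] by force

lemma phi_less_mass:
  assumes "s > 0"
  shows "phi s < 1 - prob {0}"
proof -
  have "phi s < expectation (indicator {0<..})"
    unfolding phi_def
    by (rule expectation_less) (use assms in \<open>auto intro!: integrable_const_bound[where B = 1]\<close>)
  then show ?thesis by (simp add: prob_open_half_line)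
qed

text \<open>
  On \<open>t > s / \<epsilon>\<close> the kernel \<open>t / (s + t)\<close> exceeds \<open>1 / (1 + \<epsilon>)\<close>.
\<close>
lemma tail_le_phi:
  assumes "s > 0" "e > 0"
  shows "tail (s / e) \<le> (1 + e) * phi s"
proof -
  have "expectation (indicator {s / e<..}) \<le> expectation (\<lambda>t. (1 + e) * (t / (s + t)))"
  proof (rule integral_mono_AE)
    show "AE t in M. indicator {s / e<..} t \<le> (1 + e) * (t / (s + t))"
      using nonneg
      by eventually_elim (use assms in \<open>auto simp: indicator_def divide_simps algebra_simps\<close>)
    show "integrable M (\<lambda>t. (1 + e) * (t / (s + t)))"
      by (rule integrable_mult_right) (use assms in simp)
  qed (auto intro!: integrable_const_bound[where B = 1])
  also have "\<dots> = (1 + e) * phi s"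
    unfolding phi_def by (rule Bochner_Integration.integral_mult_right_zero)
  finally show ?thesis by simp
qed

text \<open>
  On \<open>t > \<epsilon> s\<close> the kernel is at most 1. On \<open>t \<le> \<epsilon> s\<close> it is small, but what matters is that it can
  be bounded by \<open>2 \<epsilon>\<close> times the kernel at \<open>\<epsilon> s\<close>: the error is then expressed by \<open>phi\<close> itself
  rather than by a truncated first moment.
\<close>
lemma phi_le_tail_plus:
  assumes "s > 0" "e > 0" "e \<le> 1"
  shows "phi s \<le> tail (e * s) + 2 * e * phi (e * s)"
proof -
  have pointwise: "t / (s + t) \<le> indicator {e * s<..} t + 2 * e * (t / (e * s + t))"
    if t: "t \<ge> 0" for t
  proof (cases "t > e * s")
    case True
    have "t / (s + t) \<le> 1" using t assms by simp
    moreover have "0 \<le> 2 * e * (t / (e * s + t))" using t assms by simp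
    ultimately show ?thesis using True by simp
  next
    case False
    have "e * t \<ge> 0" using t assms by simp
    then have "e * s + t \<le> 2 * e * (s + t)" using False by (simp add: algebra_simps)
    then have "t * (e * s + t) \<le> t * (2 * e * (s + t))" using t by (rule mult_left_mono)
    moreover have "s + t > 0" "e * s + t > 0" using t assms by (auto intro: add_pos_nonneg)
    ultimately have "t / (s + t) \<le> 2 * e * t / (e * s + t)"
      by (simp add: divide_simps mult_ac)
    then show ?thesis using False by simp
  qed
  have int: "integrable M (\<lambda>t. t / (e * s + t))" using assms by simp
  then have int': "integrable M (\<lambda>t. 2 * e * (t / (e * s + t)))"
    by (rule integrable_mult_right)
  have ind: "integrable M (indicator {e * s<..} :: real \<Rightarrow> real)"
    by (auto intro!: integrable_const_bound[where B = 1])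
  have "phi s \<le> expectation (\<lambda>t. indicator {e * s<..} t + 2 * e * (t / (e * s + t)))"
    unfolding phi_def
  proof (rule integral_mono_AE)
    show "AE t in M. t / (s + t) \<le> indicator {e * s<..} t + 2 * e * (t / (e * s + t))"
      using nonneg by eventually_elim (rule pointwise)
  qed (use assms int' ind in \<open>auto simp del: times_divide_eq_right\<close>)
  also have "\<dots> = tail (e * s) + 2 * e * phi (e * s)"
    using Bochner_Integration.integral_add[OF ind int'] Bochner_Integration.integral_mult_right_zero[of M "2 * e"]
    by (simp add: phi_def del: times_divide_eq_right)
  finally show ?thesis .
qed

lemma phi_at_top: "(phi \<longlongrightarrow> 0) at_top"
proof -
  have "((\<lambda>s. expectation (\<lambda>t. t / (s + t))) \<longlongrightarrow> expectation (\<lambda>_. 0)) at_top"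
  proof (rule integral_dominated_convergence_at_top[where w = "\<lambda>_. 1"])
    show "\<forall>\<^sub>F s in at_top. AE t in M. norm (t / (s + t)) \<le> 1"
      using eventually_gt_at_top[of 0]
    proof eventually_elim
      case (elim s)
      show ?case using nonneg by eventually_elim (use elim in \<open>auto simp: divide_simps\<close>)
    qed
    have "((\<lambda>s. t / (s + t)) \<longlongrightarrow> 0) at_top" for t :: real by real_asymp
    then show "AE t in M. ((\<lambda>s. t / (s + t)) \<longlongrightarrow> 0) at_top" by simp
  qed auto
  then show ?thesis unfolding phi_def by simp
qed

text \<open>
  As the argument decreases to 0 the kernel tends to the indicator of the open half-line. The
  limit is parametrised by \<open>1 / x\<close> with \<open>x \<rightarrow> \<infinity>\<close>.
\<close>
lemma phi_at_0: "((\<lambda>x. phi (1 / x)) \<longlongrightarrow> 1 - prob {0}) at_top"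
proof -
  have "((\<lambda>x. expectation (\<lambda>t. t / (1 / x + t))) \<longlongrightarrow> expectation (indicator {0<..})) at_top"
  proof (rule integral_dominated_convergence_at_top[where w = "\<lambda>_. 1"])
    show "\<forall>\<^sub>F x in at_top. AE t in M. norm (t / (1 / x + t)) \<le> 1"
      using eventually_gt_at_top[of 0]
    proof eventually_elim
      case (elim x)
      then have "1 / x > 0" by simp
      show ?case using nonneg
      proof eventually_elim
        case (elim t)
        then show ?case
          using kernel_bounds[OF \<open>1 / x > 0\<close>, of t] unfolding real_norm_def by linarith
      qed
    qed
    have "((\<lambda>x. t / (1 / x + t)) \<longlongrightarrow> 1) at_top" if "t > 0" for t :: real
      using that by real_asymp
    then have "((\<lambda>x. t / (1 / x + t)) \<longlongrightarrow> indicator {0<..} t) at_top" if "t \<ge> 0" for t :: real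
      using that by (cases "t = 0") auto
    then show "AE t in M. ((\<lambda>x. t / (1 / x + t)) \<longlongrightarrow> indicator {0<..} t) at_top"
      using nonneg by (auto elim: eventually_mono)
  qed auto
  then show ?thesis by (simp add: phi_def prob_open_half_line)
qed

text \<open>
  The transform is Lipschitz away from 0, which gives its continuity.
\<close>
lemma phi_diff_le:
  assumes "0 < s" "s \<le> s'"
  shows "phi s - phi s' \<le> (s' - s) / s"
proof -
  have "phi s - phi s' = expectation (\<lambda>t. t / (s + t) - t / (s' + t))"
    using assms by (simp add: phi_def)
  also have "\<dots> \<le> expectation (\<lambda>_. (s' - s) / s)"
  proof (rule integral_mono_AE)
    have "t / (s + t) - t / (s' + t) \<le> (s' - s) / s" if "t \<ge> 0" for t
    proof -
      have "t / (s + t) - t / (s' + t) = (s' - s) / (s + t) * (t / (s' + t))"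
        using assms that by (simp add: divide_simps) (simp add: algebra_simps)
      also have "\<dots> \<le> (s' - s) / s * 1"
        using assms that by (intro mult_mono divide_left_mono) auto
      finally show ?thesis by simp
    qed
    then show "AE t in M. t / (s + t) - t / (s' + t) \<le> (s' - s) / s"
      using nonneg by auto
  qed (use assms in auto)
  also have "\<dots> = (s' - s) / s" using prob_space by simp
  finally show ?thesis .
qed

lemma phi_continuous: "continuous_on {0<..} phi"
  unfolding continuous_on_def
proof
  fix s :: real assume "s \<in> {0<..}"
  then have s: "s > 0" by simp
  have bound: "norm (phi x - phi s) \<le> \<bar>x - s\<bar> / min x s" if "x > 0" for x
    using s that phi_diff_le[of x s] phi_diff_le[of s x] phi_antimono[of x s] phi_antimono[of s x]
    by (cases "x \<le> s") (auto simp: min_def abs_real_def)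
  have "\<forall>\<^sub>F x in at s within {0<..}. norm (phi x - phi s) \<le> \<bar>x - s\<bar> / min x s"
    using bound by (auto simp: eventually_at_filter)
  moreover have "((\<lambda>x. \<bar>x - s\<bar> / min x s) \<longlongrightarrow> \<bar>s - s\<bar> / min s s) (at s within {0<..})"
    by (intro tendsto_intros) (use s in auto)
  then have "((\<lambda>x. \<bar>x - s\<bar> / min x s) \<longlongrightarrow> 0) (at s within {0<..})" by simp
  ultimately have "((\<lambda>x. phi x - phi s) \<longlongrightarrow> 0) (at s within {0<..})"
    by (rule Lim_null_comparison)
  then show "(phi \<longlongrightarrow> phi s) (at s within {0<..})" using LIM_zero_iff by blast
qed

lemma phi_surj:
  assumes "0 < c" "c < 1 - prob {0}"
  obtains s where "s > 0" "phi s = c"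
proof -
  have "\<forall>\<^sub>F x in at_top. c < phi (1 / x) \<and> x > 0"
    using order_tendstoD(1)[OF phi_at_0 assms(2)] eventually_gt_at_top[of 0]
    by eventually_elim simp
  then obtain x where x: "c < phi (1 / x)" "x > 0"
    by (auto simp: eventually_at_top_linorder)
  have "\<forall>\<^sub>F s in at_top. phi s < c \<and> s > 1 / x"
    using order_tendstoD(2)[OF phi_at_top assms(1)] eventually_gt_at_top[of "1 / x"]
    by eventually_elim simp
  then obtain s where s: "phi s < c" "1 / x < s"
    by (auto simp: eventually_at_top_linorder)
  have "continuous_on {1 / x..s} phi"
    using phi_continuous by (rule continuous_on_subset) (use x in \<open>auto intro: less_le_trans[of _ "1 / x"]\<close>)
  then obtain u where "1 / x \<le> u" "phi u = c"
    using IVT2'[of phi s c "1 / x"] s x by force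
  then show ?thesis using that[of u] x by (meson less_le_trans divide_pos_pos zero_less_one)
qed


section \<open>Tail and transform vary slowly together\<close>

text \<open>
  With \<open>phi\<close> slowly varying, both estimates can be divided by \<open>phi(s)\<close>: for every \<open>\<epsilon>\<close> they bound
  the ratio \<open>tail / phi\<close> in the limit by \<open>1 - 2 \<epsilon>\<close> from below and by \<open>1 + \<epsilon>\<close> from above.
\<close>
lemma tail_asymp_phi:
  assumes slow: "varies_slowly phi"
  shows "((\<lambda>x. tail x / phi x) \<longlongrightarrow> 1) at_top"
proof (rule order_tendstoI)
  fix u :: real assume u: "u < 1"
  define e where "e = min 1 ((1 - u) / 4)"
  have e: "e > 0" "e \<le> 1" "u < 1 - 2 * e" using u by (auto simp: e_def min_def field_simps)
  have "((\<lambda>s. phi (1 / e * s) / phi s - 2 * e) \<longlongrightarrow> 1 - 2 * e) at_top"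
    using e(1) by (intro tendsto_intros varies_slowlyD[OF slow]) simp
  from order_tendstoD(1)[OF this e(3)] eventually_gt_at_top[of 0]
  show "\<forall>\<^sub>F s in at_top. u < tail s / phi s"
  proof eventually_elim
    case (elim s)
    have "phi (1 / e * s) \<le> tail s + 2 * e * phi s"
      using phi_le_tail_plus[of "1 / e * s" e] e elim by simp
    then have "phi (1 / e * s) / phi s \<le> (tail s + 2 * e * phi s) / phi s"
      using phi_pos[OF elim(2)] by (intro divide_right_mono) auto
    then have "phi (1 / e * s) / phi s - 2 * e \<le> tail s / phi s"
      using phi_pos[OF elim(2)] by (simp add: add_divide_distrib)
    with elim show ?case by linarith
  qed
next
  fix u :: real assume u: "1 < u"
  define e where "e = (u - 1) / 2"
  have e: "e > 0" "1 + e < u" using u by (auto simp: e_def field_simps)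
  have "((\<lambda>s. (1 + e) * (phi (e * s) / phi s)) \<longlongrightarrow> (1 + e) * 1) at_top"
    using e(1) by (intro tendsto_intros varies_slowlyD[OF slow])
  then have "\<forall>\<^sub>F s in at_top. (1 + e) * (phi (e * s) / phi s) < u"
    using order_tendstoD(2) e(2) by fastforce
  from this eventually_gt_at_top[of 0]
  show "\<forall>\<^sub>F s in at_top. tail s / phi s < u"
  proof eventually_elim
    case (elim s)
    have "tail s \<le> (1 + e) * phi (e * s)"
      using tail_le_phi[of "e * s" e] e elim by simp
    then have "tail s / phi s \<le> (1 + e) * (phi (e * s) / phi s)"
      using phi_pos[OF elim(2)] by (simp add: field_simps)
    with elim show ?case by linarith
  qed
qed

lemma tail_antimono: "x \<le> y \<Longrightarrow> tail y \<le> tail x"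
  by (intro finite_measure_mono) auto

text \<open>
  A crude form of Karamata's theorem. The estimate \<open>phi(4 s) \<le> tail(s) + phi(s) / 2\<close> contracts by
  1/2 at each step, whereas a slowly varying tail loses at most the factor 3/4 from \<open>s\<close> to \<open>4 s\<close>.
  Hence a bound \<open>phi \<le> C tail\<close> passes from \<open>s\<close> to \<open>4 s\<close> as soon as
  \<open>1 + C / 2 \<le> 3 C / 4\<close>, that is, \<open>C \<ge> 4\<close>.
\<close>
lemma phi_le_const_tail:
  assumes slow: "varies_slowly tail" and pos: "\<And>x. tail x > 0"
  obtains C where "C > 0" "\<forall>\<^sub>F s in at_top. phi s \<le> C * tail s"
proof -
  have "((\<lambda>s. tail (4 * s) / tail s) \<longlongrightarrow> 1) at_top"
    using slow unfolding varies_slowly_def by auto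
  from order_tendstoD(1)[OF this, of "3 / 4"]
  obtain s1 where s1: "\<And>s. s \<ge> s1 \<Longrightarrow> 3 / 4 < tail (4 * s) / tail s"
    by (auto simp: eventually_at_top_linorder)
  define s0 where "s0 = max s1 1"
  have s0: "s0 > 0" "s0 \<ge> s1" by (auto simp: s0_def)
  (* The second term makes the bound hold on the fundamental interval, where phi is at most 1. *)
  define C where "C = max 4 (1 / tail (4 * s0))"
  have C: "C \<ge> 4" "C * tail (4 * s0) \<ge> 1"
    using pos[of "4 * s0"] by (auto simp: C_def max_def field_simps)
  have "phi s \<le> C * tail s" if "s0 \<le> s" for s
  proof (rule scaling_induct[of 4 s0 "\<lambda>s. phi s \<le> C * tail s", OF _ s0(1) _ _ that])
    fix s assume s: "s0 \<le> s" "s \<le> 4 * s0"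
    then have "phi s < 1 - prob {0}" using s0 by (intro phi_less_mass) simp
    also have "\<dots> \<le> 1" by simp
    also have "1 \<le> C * tail (4 * s0)" by (rule C(2))
    also have "\<dots> \<le> C * tail s" using C(1) s by (intro mult_left_mono tail_antimono) auto
    finally show "phi s \<le> C * tail s" by simp
  next
    fix s assume s: "s0 \<le> s" and IH: "phi s \<le> C * tail s"
    have "3 * tail s \<le> 4 * tail (4 * s)"
      using s1[of s] s s0 pos[of s] by (simp add: field_simps)
    moreover have "phi (4 * s) \<le> tail s + 1 / 2 * phi s"
      using phi_le_tail_plus[of "4 * s" "1 / 4"] s s0 by simp
    ultimately have "phi (4 * s) \<le> (1 + C / 2) * tail s"
      using IH by (simp add: algebra_simps)
    also have "\<dots> \<le> 3 / 4 * C * tail s"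
      using C(1) pos[of s] by (intro mult_right_mono) auto
    also have "\<dots> = C / 4 * (3 * tail s)" by simp
    also have "\<dots> \<le> C / 4 * (4 * tail (4 * s))"
      using C(1) \<open>3 * tail s \<le> 4 * tail (4 * s)\<close> by (intro mult_left_mono) auto
    finally show "phi (4 * s) \<le> C * tail (4 * s)" by simp
  qed auto
  then have "\<forall>\<^sub>F s in at_top. phi s \<le> C * tail s"
    using eventually_at_top_linorder by blast
  then show ?thesis using that[of C] C(1) by simp
qed

text \<open>
  The same two estimates, now divided by the tail; the error term \<open>2 \<epsilon> phi(\<epsilon> s)\<close> is at most
  \<open>2 \<epsilon> C tail(\<epsilon> s)\<close> and so disappears with \<open>\<epsilon>\<close>.
\<close>
lemma phi_asymp_tail:
  assumes slow: "varies_slowly tail" and pos: "\<And>x. tail x > 0"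
  shows "((\<lambda>x. phi x / tail x) \<longlongrightarrow> 1) at_top"
proof (rule order_tendstoI)
  fix u :: real assume u: "u < 1"
  define e where "e = (1 - max u 0) / 2"
  (* For the above e and u > 0, the claim u < 1 / (1 + e) amounts to (1 - u) * (2 - u) > 0. *)
  have "(1 - u) * (2 - u) > 0" using u by simp
  then have e: "e > 0" "u < 1 / (1 + e)" using u by (auto simp: e_def max_def field_simps)
  have "((\<lambda>s. tail (1 / e * s) / tail s / (1 + e)) \<longlongrightarrow> 1 / (1 + e)) at_top"
    using e(1) by (intro tendsto_intros varies_slowlyD[OF slow]) simp_all
  from order_tendstoD(1)[OF this e(2)] eventually_gt_at_top[of 0]
  show "\<forall>\<^sub>F s in at_top. u < phi s / tail s"
  proof eventually_elim
    case (elim s)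
    have "tail (1 / e * s) \<le> (1 + e) * phi s"
      using tail_le_phi[of s e] e elim by simp
    then have "tail (1 / e * s) / tail s / (1 + e) \<le> phi s / tail s"
      using pos[of s] e(1) by (simp add: divide_simps mult_ac)
    with elim show ?case by linarith
  qed
next
  fix u :: real assume u: "1 < u"
  obtain C where C: "C > 0" "\<forall>\<^sub>F s in at_top. phi s \<le> C * tail s"
    using phi_le_const_tail[OF assms] .
  define e where "e = min 1 ((u - 1) / (4 * C))"
  have e: "e > 0" "e \<le> 1" using u C by (auto simp: e_def)
  have "e \<le> (u - 1) / (4 * C)" by (simp add: e_def)
  then have "4 * C * e \<le> u - 1" using C by (simp add: field_simps)
  then have eC: "1 + 2 * e * C < u" using u by (simp add: algebra_simps)
  have "((\<lambda>s. (1 + 2 * e * C) * (tail (e * s) / tail s)) \<longlongrightarrow> (1 + 2 * e * C) * 1) at_top"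
    using e(1) by (intro tendsto_intros varies_slowlyD[OF slow])
  then have "\<forall>\<^sub>F s in at_top. (1 + 2 * e * C) * (tail (e * s) / tail s) < u"
    using order_tendstoD(2) eC by fastforce
  moreover have "\<forall>\<^sub>F s in at_top. phi (e * s) \<le> C * tail (e * s)"
    using filterlim_iff[THEN iffD1, OF filterlim_mult_at_top[OF e(1)], rule_format, OF C(2)] .
  ultimately show "\<forall>\<^sub>F s in at_top. phi s / tail s < u"
    using eventually_gt_at_top[of 0]
  proof eventually_elim
    case (elim s)
    have "phi s \<le> tail (e * s) + 2 * e * phi (e * s)"
      using phi_le_tail_plus elim e by simp
    also have "\<dots> \<le> tail (e * s) + 2 * e * (C * tail (e * s))"
      using elim e by (intro add_left_mono mult_left_mono) auto
    finally have "phi s / tail s \<le> (1 + 2 * e * C) * (tail (e * s) / tail s)"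
      using pos[of s] by (simp add: field_simps)
    with elim show ?case by linarith
  qed
qed


section \<open>The inverse function of the transform\<close>

lemma psi_inj: "inj_on (psi M) {..<0}"
proof (rule inj_onI)
  fix z w :: real assume zw: "z \<in> {..<0}" "w \<in> {..<0}" "psi M z = psi M w"
  have "psi M z = - phi (- 1 / z)" "psi M w = - phi (- 1 / w)"
    using psi_eq[of "- 1 / z"] psi_eq[of "- 1 / w"] zw by (auto simp: divide_neg_neg)
  then have "- 1 / z = - 1 / w"
    using zw phi_le_iff[of "- 1 / z" "- 1 / w"] phi_le_iff[of "- 1 / w" "- 1 / z"]
    by (force simp: divide_neg_neg)
  then show "z = w" using zw by (simp add: field_simps)
qed

lemma chi_phi:
  assumes "s > 0"
  shows "chi M (- phi s) = - 1 / s"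
  unfolding chi_def psi_eq[OF assms, symmetric]
  using assms by (intro the_inv_into_f_f psi_inj) auto

lemma f_fun_inverse_phi:
  assumes "s > 0"
  shows "f_fun M (1 / phi s) = s"
  using chi_phi[OF assms] assms by (simp add: f_fun_def)

lemma domain_inverse_phi:
  assumes "s > 0"
  shows "1 / phi s > 1 / (1 - prob {0})"
  using phi_less_mass[OF assms] phi_pos[OF assms] by (intro divide_strict_left_mono) auto

text \<open>
  The domain of \<open>f_fun M\<close> is the range of \<open>1 / phi\<close>; the surjectivity of \<open>phi\<close> is used here.
\<close>
lemma domain_cases:
  assumes "x > 1 / (1 - prob {0})"
  obtains s where "s > 0" "x = 1 / phi s"
proof -
  have m: "1 - prob {0} > 0" using not_all_at_0 by simp
  then have x: "x > 0" using assms by (meson less_trans divide_pos_pos zero_less_one)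
  then have "1 / x < 1 - prob {0}" using assms m by (simp add: field_simps)
  then obtain s where "s > 0" "phi s = 1 / x" using phi_surj[of "1 / x"] x by auto
  then show ?thesis using that[of s] by simp
qed

lemma domain_gt_1:
  assumes "x > 1 / (1 - prob {0})"
  shows "x > 1"
proof -
  have "1 / (1 - prob {0}) \<ge> 1" using not_all_at_0 by simp
  with assms show ?thesis by linarith
qed

lemma f_fun_pos: "x > 1 / (1 - prob {0}) \<Longrightarrow> f_fun M x > 0"
  using domain_cases[of x] f_fun_inverse_phi by metis

lemma phi_f_fun: "x > 1 / (1 - prob {0}) \<Longrightarrow> phi (f_fun M x) = 1 / x"
  using domain_cases[of x] f_fun_inverse_phi by (metis divide_divide_eq_right mult_1 div_by_1)

lemma f_fun_eq_S_transform:
  assumes "x > 1 / (1 - prob {0})"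
  shows "f_fun M x = (x - 1) / S_transform M (- 1 / x)"
proof -
  obtain s where s: "s > 0" "x = 1 / phi s" using domain_cases[OF assms] .
  have x1: "x > 1" using domain_gt_1[OF assms] .
  have "chi M (- 1 / x) = - 1 / s" using chi_phi[OF s(1)] s(2) by simp
  moreover have "(- 1 / x + 1) / (- 1 / x) = 1 - x" using x1 by (simp add: field_simps)
  ultimately have "S_transform M (- 1 / x) = (1 - x) * (- 1 / s)"
    unfolding S_transform_def by (simp only:)
  also have "\<dots> = (x - 1) / s" by (simp add: diff_divide_distrib)
  finally have "S_transform M (- 1 / x) = (x - 1) / s" .
  moreover have "f_fun M x = s" using f_fun_inverse_phi[OF s(1)] s(2) by simp
  ultimately show ?thesis using x1 s(1) by simp
qed

lemma inverse_S_transform: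
  assumes "x > 1 / (1 - prob {0})"
  shows "1 / S_transform M (- 1 / x) = f_fun M x / (x - 1)"
  using f_fun_eq_S_transform[OF assms] domain_gt_1[OF assms] by simp

lemma inverse_f_inv:
  assumes "s > 0"
  shows "1 / f_inv M s = phi s"
proof -
  have "inj_on (f_fun M) {1 / (1 - prob {0})<..}"
    by (rule inj_on_inverseI[where g = "\<lambda>s. 1 / phi s"]) (use phi_f_fun in auto)
  then have "f_inv M (f_fun M (1 / phi s)) = 1 / phi s"
    unfolding f_inv_def by (rule the_inv_into_f_f) (use domain_inverse_phi[OF assms] in auto)
  then show ?thesis using f_fun_inverse_phi[OF assms] by simp
qed

lemma f_fun_mono: "mono_on {1 / (1 - prob {0})<..} (f_fun M)"
proof (rule mono_onI)
  fix x y assume xy: "x \<in> {1 / (1 - prob {0})<..}" "y \<in> {1 / (1 - prob {0})<..}" "x \<le> y"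
  then have "1 / y \<le> 1 / x" using domain_gt_1[of x] by (intro divide_left_mono) auto
  then show "f_fun M x \<le> f_fun M y"
    using xy phi_f_fun[of x] phi_f_fun[of y] phi_le_iff[of "f_fun M y" "f_fun M x"]
      f_fun_pos[of x] f_fun_pos[of y] by simp
qed

lemma inverse_f_inv_pos_measurable: "pos_measurable_near_infinity (\<lambda>x. 1 / f_inv M x)"
proof -
  have "mono_on {0<..} (\<lambda>s. - phi s)" by (intro mono_onI) (simp add: phi_antimono)
  then have "(\<lambda>s. - phi s) \<in> borel_measurable (restrict_space borel {0<..})"
    by (rule borel_measurable_mono_on_fnc)
  then have "phi \<in> borel_measurable (restrict_space borel {0<..})"
    by simp
  then have "(\<lambda>x. 1 / f_inv M x) \<in> borel_measurable (restrict_space borel {0<..})"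
    by (subst measurable_cong[where g = phi]) (auto simp: space_restrict_space inverse_f_inv)
  moreover have "\<forall>x>0. 1 / f_inv M x > 0" by (simp add: inverse_f_inv phi_pos del: zero_less_divide_1_iff)
  ultimately show ?thesis unfolding pos_measurable_near_infinity_def by blast
qed

lemma inverse_S_pos_measurable:
  "pos_measurable_near_infinity (\<lambda>x. 1 / S_transform M (- 1 / x))"
  unfolding pos_measurable_near_infinity_def
proof (intro exI[of _ "1 / (1 - prob {0})"] conjI allI impI)
  let ?R = "restrict_space borel {1 / (1 - prob {0})<..}"
  have "f_fun M \<in> borel_measurable ?R" by (rule borel_measurable_mono_on_fnc[OF f_fun_mono])
  then have "(\<lambda>x. f_fun M x / (x - 1)) \<in> borel_measurable ?R"
    by (rule borel_measurable_divide) (auto intro: measurable_restrict_space1)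
  then show "(\<lambda>x. 1 / S_transform M (- 1 / x)) \<in> borel_measurable ?R"
  proof (rule measurable_cong[THEN iffD2, rotated])
    fix x assume "x \<in> space ?R"
    then show "1 / S_transform M (- 1 / x) = f_fun M x / (x - 1)"
      using inverse_S_transform[of x] by (simp add: space_restrict_space)
  qed
  fix x assume x: "x > 1 / (1 - prob {0})"
  show "1 / S_transform M (- 1 / x) > 0"
    unfolding inverse_S_transform[OF x] using f_fun_pos[OF x] domain_gt_1[OF x] by simp
qed


section \<open>Slow variation of the transform and rapid growth of its inverse\<close>

text \<open>
  The uniformity in \<open>l\<close> comes from iterating one inequality, \<open>phi(s) \<le> a\<^bsup>1/D\<^esup> phi(a s)\<close> for large
  \<open>s\<close>. Rounding \<open>l\<^sup>D\<close> down to a power of \<open>a\<close> costs at most one factor \<open>a\<close>, which is why the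
  argument on the right is divided by \<open>a\<close>, and no constant is lost outside \<open>phi\<close>.
\<close>
lemma phi_potter:
  assumes slow: "varies_slowly phi" and a: "a > 1" and D: "D > 0"
  obtains s0 where "s0 > 0"
    "\<And>s l. s \<ge> s0 \<Longrightarrow> l \<ge> 1 \<Longrightarrow> phi s \<le> l * phi (l powr D * s / a)"
proof -
  define b where "b = a powr (1 / D)"
  have b: "b > 1" unfolding b_def using a D by simp
  have "((\<lambda>s. phi (a * s) / phi s) \<longlongrightarrow> 1) at_top"
    using slow a unfolding varies_slowly_def by auto
  from order_tendstoD(1)[OF this, of "1 / b"] b
  obtain s1 where s1: "\<And>s. s \<ge> s1 \<Longrightarrow> 1 / b < phi (a * s) / phi s"
    by (auto simp: eventually_at_top_linorder)
  define s0 where "s0 = max s1 1"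
  have s0: "s0 > 0" "s0 \<ge> s1" by (auto simp: s0_def)
  have step: "phi s \<le> b * phi (a * s)" if "s \<ge> s0" for s
    using s1[of s] that s0 b phi_pos[of s] by (simp add: field_simps)
  have pow: "phi s \<le> b ^ n * phi (a ^ n * s)" if s: "s \<ge> s0" for s n
  proof (induction n)
    case (Suc n)
    have "1 * s \<le> a ^ n * s" using a s s0 by (intro mult_right_mono) auto
    then have "phi (a ^ n * s) \<le> b * phi (a * (a ^ n * s))" using s by (intro step) simp
    then have "b ^ n * phi (a ^ n * s) \<le> b ^ n * (b * phi (a * (a ^ n * s)))"
      using b by (intro mult_left_mono) auto
    with Suc.IH show ?case by (simp add: mult_ac)
  qed simp
  have "phi s \<le> l * phi (l powr D * s / a)" if s: "s \<ge> s0" and l: "l \<ge> 1" for s l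
  proof -
    have "l powr D \<ge> 1" using l D by (simp add: ge_one_powr_ge_zero)
    then have lg: "log a (l powr D) \<ge> 0" using a by (subst zero_le_log_cancel_iff) auto
    define n where "n = nat \<lfloor>log a (l powr D)\<rfloor>"
    have n: "real n \<le> log a (l powr D)" "log a (l powr D) < real n + 1"
      using lg by (auto simp: n_def)
    have l1: "l powr D \<le> a ^ n * a"
    proof -
      have "l powr D = a powr (log a (l powr D))" using a l by simp
      also have "\<dots> \<le> a powr (real n + 1)" using n a by (intro powr_mono) auto
      also have "\<dots> = a ^ n * a" using a by (simp add: powr_add powr_realpow)
      finally show ?thesis .
    qed
    have l2: "b ^ n \<le> l"
    proof -
      have "b ^ n = a powr (real n / D)"
        using b a by (simp add: b_def powr_powr flip: powr_realpow)
      also have "\<dots> \<le> a powr (log a (l powr D) / D)"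
        using n a D by (intro powr_mono divide_right_mono) auto
      also have "\<dots> = l" using a l D by (simp add: log_powr)
      finally show ?thesis .
    qed
    have "l powr D * s / a \<le> a ^ n * s"
      using l1 s s0 a by (simp add: field_simps)
    then have "phi (a ^ n * s) \<le> phi (l powr D * s / a)"
      using l s s0 a by (intro phi_antimono) auto
    then have "b ^ n * phi (a ^ n * s) \<le> l * phi (l powr D * s / a)"
      using l l2 b phi_pos[of "a ^ n * s"] s s0 a by (intro mult_mono) (auto intro: less_imp_le)
    with pow[OF s, of n] show ?thesis by linarith
  qed
  with that s0(1) show ?thesis by blast
qed

text \<open>
  Put \<open>s = f_fun M x\<close> in the Potter bound, so that \<open>phi(s) = 1 / x\<close>: it reads
  \<open>phi(l\<^sup>D s / a) \<ge> 1 / (l x) = phi(f_fun M (l x))\<close>, and \<open>phi\<close> is decreasing. Passing from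
  \<open>f_fun M x\<close> to \<open>f_fun M x / (x - 1)\<close> costs one power of \<open>l\<close> and the factor \<open>1 - 1 / x\<close>.
\<close>
lemma KR_infinity_if_phi_slow:
  assumes slow: "varies_slowly phi"
  shows "(\<lambda>x. 1 / S_transform M (- 1 / x)) \<in> KR_infinity"
proof -
  let ?g = "\<lambda>x. 1 / S_transform M (- 1 / x)"
  let ?x0 = "1 / (1 - prob {0})"
  have "1 \<le> Liminf at_top (\<lambda>x. INF l\<in>{1..}. ereal (?g (l * x) / (l powr d * ?g x)))" for d :: real
    unfolding le_Liminf_iff
  proof (intro allI impI)
    fix y :: ereal assume "y < 1"
    then obtain c' where c': "y < ereal c'" "c' < 1"
      using ereal_dense2[of y 1] by (auto simp: one_ereal_def)
    define c where "c = max c' (1 / 2)"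
    have c: "y < ereal c" "c < 1" "c > 0"
      using c' less_le_trans[OF c'(1), of "ereal c"] by (auto simp: c_def)
    define a where "a = (1 + 1 / c) / 2"
    have a: "a > 1" "c < 1 / a" using c by (auto simp: a_def field_simps)
    (* The Potter bound is stated for positive exponents; as l is at least 1, raising
       an exponent below 1 to 1 only strengthens the claim. *)
    define D where "D = max 1 (d + 1)"
    have D: "D > 0" "D \<ge> d + 1" by (auto simp: D_def)
    obtain s0 where s0: "s0 > 0"
      "\<And>s l. s \<ge> s0 \<Longrightarrow> l \<ge> 1 \<Longrightarrow> phi s \<le> l * phi (l powr D * s / a)"
      using phi_potter[OF slow a(1) D(1)] by blast
    have "((\<lambda>x. 1 / a * (1 - 1 / x)) \<longlongrightarrow> 1 / a) at_top" using a(1) by real_asymp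
    from order_tendstoD(1)[OF this a(2)] eventually_gt_at_top[of ?x0]
      eventually_ge_at_top[of "1 / phi s0"]
    show "\<forall>\<^sub>F x in at_top. y < (INF l\<in>{1..}. ereal (?g (l * x) / (l powr d * ?g x)))"
    proof eventually_elim
      case (elim x)
      have x1: "x > 1" using domain_gt_1 elim by blast
      define s where "s = f_fun M x"
      have s: "s > 0" "phi s = 1 / x" using f_fun_pos phi_f_fun elim by (auto simp: s_def)
      have "1 / x \<le> phi s0" using elim(3) x1 phi_pos[OF s0(1)] by (simp add: field_simps)
      then have "phi s \<le> phi s0" using s(2) by simp
      then have ss0: "s \<ge> s0" using phi_le_iff s s0 by blast
      have "c \<le> ?g (l * x) / (l powr d * ?g x)" if l: "l \<ge> 1" for l
      proof -
        have "1 * x \<le> l * x" using l x1 by (intro mult_right_mono) auto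
        then have lx: "l * x > ?x0" using elim by linarith
        have lx1: "l * x > 1" using domain_gt_1[OF lx] .
        have "1 / x \<le> l * phi (l powr D * s / a)" using s0(2)[OF ss0 l] s(2) by simp
        then have "1 / x / l \<le> phi (l powr D * s / a)"
          using l by (subst pos_divide_le_eq) (auto simp: mult.commute)
        then have "phi (f_fun M (l * x)) \<le> phi (l powr D * s / a)"
          using phi_f_fun[OF lx] by (simp add: mult.commute)
        then have f: "l powr D * s / a \<le> f_fun M (l * x)"
          using phi_le_iff f_fun_pos[OF lx] s a l by simp
        have "l powr (d + 1) \<le> l powr D" using l D by (intro powr_mono) auto
        then have "l powr (d + 1) * s / a \<le> l powr D * s / a"
          using s a by (intro divide_right_mono mult_right_mono) auto
        also note f
        finally have "l powr d * l * s / a \<le> f_fun M (l * x)"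
          using l by (simp add: powr_add)
        then have "l powr d * l * s / a / (l * x) \<le> f_fun M (l * x) / (l * x)"
          using lx1 by (intro divide_right_mono) auto
        also have "\<dots> \<le> f_fun M (l * x) / (l * x - 1)"
          using lx1 f_fun_pos[OF lx] by (intro divide_left_mono) auto
        also have "\<dots> = ?g (l * x)" using inverse_S_transform[OF lx] by simp
        finally have g: "l powr d * s / a / x \<le> ?g (l * x)"
          using l by simp
        have gx: "?g x = s / (x - 1)" using inverse_S_transform elim by (simp add: s_def)
        have "c \<le> 1 / a * (1 - 1 / x)" using elim by simp
        also have "\<dots> = (l powr d * s / a / x) / (l powr d * (s / (x - 1)))"
          using l x1 s a by (simp add: field_simps)
        also have "\<dots> \<le> ?g (l * x) / (l powr d * (s / (x - 1)))"
          using g l s x1 by (intro divide_right_mono) auto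
        finally show ?thesis unfolding gx .
      qed
      then have "ereal c \<le> (INF l\<in>{1..}. ereal (?g (l * x) / (l powr d * ?g x)))"
        by (intro INF_greatest) auto
      with c(1) show ?case by (rule less_le_trans)
    qed
  qed
  then show ?thesis
    unfolding KR_infinity_def using inverse_S_pos_measurable by blast
qed

text \<open>
  An exponent \<open>d\<close> with \<open>b\<^bsup>d+1\<^esup> = 2 a\<close> turns the growth condition at \<open>l = b\<close> into
  \<open>f_fun M (b x) \<ge> a f_fun M x\<close> for large \<open>x\<close>. At \<open>x = 1 / phi(s)\<close>, which tends to infinity with
  \<open>s\<close>, this is \<open>phi(a s) \<ge> phi(s) / b\<close>.
\<close>
lemma phi_slow_if_KR_infinity:
  assumes KR: "(\<lambda>x. 1 / S_transform M (- 1 / x)) \<in> KR_infinity"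
  shows "varies_slowly phi"
proof (rule varies_slowly_antimonoI[OF phi_antimono phi_pos])
  let ?g = "\<lambda>x. 1 / S_transform M (- 1 / x)"
  let ?x0 = "1 / (1 - prob {0})"
  fix a b :: real assume a: "a > 1" and b: "b > 1"
  (* One power of b is gained from the factor x - 1, and the 2 absorbs the lower bound 1/2. *)
  define d where "d = log b (2 * a) - 1"
  have bd: "b powr d * b = 2 * a"
    using a b by (simp add: d_def powr_diff)
  have "1 \<le> Liminf at_top (\<lambda>x. INF l\<in>{1..}. ereal (?g (l * x) / (l powr d * ?g x)))"
    using KR unfolding KR_infinity_def by blast
  moreover have "ereal (1 / 2) < 1" by (simp add: one_ereal_def)
  ultimately have "\<forall>\<^sub>F x in at_top.
      ereal (1 / 2) < (INF l\<in>{1..}. ereal (?g (l * x) / (l powr d * ?g x)))"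
    unfolding le_Liminf_iff by blast
  then have grow: "\<forall>\<^sub>F x in at_top. x > ?x0 \<longrightarrow> a * f_fun M x \<le> f_fun M (b * x)"
  proof eventually_elim
    case (elim x)
    show ?case
    proof
      assume x: "x > ?x0"
      have x1: "x > 1" using domain_gt_1[OF x] .
      have "1 * x \<le> b * x" using b x1 by (intro mult_right_mono) auto
      then have bx: "b * x > ?x0" using x by linarith
      have bx1: "b * x > 1" using domain_gt_1[OF bx] .
      have "(INF l\<in>{1..}. ereal (?g (l * x) / (l powr d * ?g x)))
              \<le> ereal (?g (b * x) / (b powr d * ?g x))"
        using b by (intro INF_lower) auto
      with elim have "ereal (1 / 2) < ereal (?g (b * x) / (b powr d * ?g x))"
        by (rule less_le_trans)
      then have "1 / 2 < (f_fun M (b * x) / (b * x - 1)) / (b powr d * (f_fun M x / (x - 1)))"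
        unfolding inverse_S_transform[OF x] inverse_S_transform[OF bx] by simp
      then have "b powr d * f_fun M x / (x - 1) / 2 \<le> f_fun M (b * x) / (b * x - 1)"
        using f_fun_pos[OF x] b x1 bx1 by (simp add: field_simps)
      then have "b powr d * f_fun M x / 2 * ((b * x - 1) / (x - 1)) \<le> f_fun M (b * x)"
        using bx1 by (simp add: field_simps)
      moreover have "b \<le> (b * x - 1) / (x - 1)" using b x1 by (simp add: field_simps)
      then have "b powr d * f_fun M x / 2 * b \<le> b powr d * f_fun M x / 2 * ((b * x - 1) / (x - 1))"
        using f_fun_pos[OF x] by (intro mult_left_mono) auto
      moreover have "b powr d * f_fun M x / 2 * b = b powr d * b * f_fun M x / 2" by simp
      then have "b powr d * f_fun M x / 2 * b = a * f_fun M x" unfolding bd by simp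
      ultimately show "a * f_fun M x \<le> f_fun M (b * x)" by linarith
    qed
  qed
  have "\<forall>\<^sub>F s in at_top. phi s > 0"
    using eventually_gt_at_top[of 0] by eventually_elim (rule phi_pos)
  then have "filterlim (\<lambda>s. 1 / phi s) at_top at_top"
    using filterlim_compose[OF filterlim_inverse_at_top_right, of phi at_top] phi_at_top
    by (simp add: filterlim_at inverse_eq_divide eventually_mono less_imp_neq)
  from filterlim_iff[THEN iffD1, OF this, rule_format, OF grow] eventually_gt_at_top[of 0]
  show "\<forall>\<^sub>F s in at_top. phi s \<le> b * phi (a * s)"
  proof eventually_elim
    case (elim s)
    define x where "x = 1 / phi s"
    have x: "x > ?x0" unfolding x_def using domain_inverse_phi elim by blast
    have x1: "x > 1" using domain_gt_1[OF x] .
    have "1 * x \<le> b * x" using b x1 by (intro mult_right_mono) auto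
    then have bx: "b * x > ?x0" using x by linarith
    have "a * s \<le> f_fun M (b * x)"
      using elim x f_fun_inverse_phi unfolding x_def by simp
    then have "phi (f_fun M (b * x)) \<le> phi (a * s)"
      using a elim by (intro phi_antimono) auto
    then have "1 / (b * x) \<le> phi (a * s)" using phi_f_fun[OF bx] by simp
    then show ?case using b phi_pos[of s] elim by (simp add: x_def field_simps)
  qed
qed

end

section \<open>Slowly varying tails and the S-transform\<close>

lemma half_line_law_M_plus:
  assumes "\<mu> \<in> M_plus" and "\<mu> \<noteq> return borel 0"
  shows "half_line_law \<mu>"
proof -
  interpret real_distribution \<mu> using assms(1) by (simp add: M_plus_def)
  have "prob {0..} = 1" using assms(1) by (simp add: M_plus_def)
  then have nonneg: "AE t in \<mu>. 0 \<le> t"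
    by (subst (asm) prob_eq_1) auto
  have "prob {0} \<noteq> 1"
  proof
    assume "prob {0} = 1"
    then have ae: "AE t in \<mu>. t = 0" by (subst (asm) prob_eq_1) auto
    have "\<mu> = return borel 0"
    proof (rule measure_eqI)
      fix A assume A: "A \<in> sets \<mu>"
      have "emeasure \<mu> A = emeasure \<mu> (if 0 \<in> A then space \<mu> else {})"
        by (rule emeasure_eq_AE) (use ae A in \<open>auto elim: eventually_mono\<close>)
      then show "emeasure \<mu> A = emeasure (return borel 0) A"
        using A emeasure_space_1 by (simp add: indicator_def)
    qed simp
    with assms(2) show False ..
  qed
  then have "prob {0} < 1" using prob_le_1[of "{0}"] by linarith
  with nonneg show ?thesis
    by (intro half_line_law.intro half_line_law_axioms.intro real_distribution_axioms)
qed

theorem theorem4p1: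
  fixes \<mu> :: "real measure"
  assumes "\<mu> \<in> M_plus" and "\<mu> \<noteq> return borel 0"
  shows "(\<forall>L\<in>slowly_varying.
            ((\<lambda>x. measure \<mu> {x<..} / L x) \<longlongrightarrow> 1) at_top \<longrightarrow>
            (\<lambda>x. 1 / S_transform \<mu> (- 1 / x)) \<in> KR_infinity)
       \<and> ((\<lambda>x. 1 / S_transform \<mu> (- 1 / x)) \<in> KR_infinity \<longrightarrow>
            (\<lambda>x. 1 / f_inv \<mu> x) \<in> slowly_varying \<and>
            ((\<lambda>x. measure \<mu> {x<..} / (1 / f_inv \<mu> x)) \<longlongrightarrow> 1) at_top)
       \<and> (\<forall>x > 1 / (1 - measure \<mu> {0}). f_fun \<mu> x = (x - 1) / S_transform \<mu> (- 1 / x))"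
proof -
  interpret half_line_law \<mu> using half_line_law_M_plus[OF assms] .
  have "(\<lambda>x. 1 / S_transform \<mu> (- 1 / x)) \<in> KR_infinity"
    if L: "L \<in> slowly_varying" and tail_L: "((\<lambda>x. tail x / L x) \<longlongrightarrow> 1) at_top" for L
  proof -
    have "varies_slowly L" using L by (simp add: slowly_varying_def varies_slowly_def)
    then have slow: "varies_slowly tail" using tail_L by (rule varies_slowly_asymp)
    have "\<forall>\<^sub>F x in at_top. tail x / L x > 0" using order_tendstoD(1)[OF tail_L] by simp
    then have ev: "\<forall>\<^sub>F x in at_top. tail x > 0"
      by eventually_elim (auto simp: zero_less_divide_iff measure_nonneg not_less[symmetric] zero_less_measure_iff)
    have pos: "tail x > 0" for x
    proof -
      obtain y where "y \<ge> x" "tail y > 0"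
        using eventually_conj[OF ev eventually_ge_at_top[of x]]
        by (auto simp: eventually_at_top_linorder)
      then show ?thesis using tail_antimono[of x y] by linarith
    qed
    have "varies_slowly phi"
      using varies_slowly_asymp[OF slow phi_asymp_tail[OF slow pos]] .
    then show ?thesis by (rule KR_infinity_if_phi_slow)
  qed
  moreover have "(\<lambda>x. 1 / f_inv \<mu> x) \<in> slowly_varying \<and>
      ((\<lambda>x. tail x / (1 / f_inv \<mu> x)) \<longlongrightarrow> 1) at_top"
    if "(\<lambda>x. 1 / S_transform \<mu> (- 1 / x)) \<in> KR_infinity"
  proof
    have slow: "varies_slowly phi" using phi_slow_if_KR_infinity[OF that] .
    have eq: "\<forall>\<^sub>F x in at_top. phi (l * x) = 1 / f_inv \<mu> (l * x)" if "l > 0" for l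
      using eventually_gt_at_top[of 0]
      by eventually_elim (use that in \<open>simp add: inverse_f_inv\<close>)
    have eq1: "\<forall>\<^sub>F x in at_top. phi x = 1 / f_inv \<mu> x" using eq[of 1] by simp
    have "((\<lambda>x. (1 / f_inv \<mu> (l * x)) / (1 / f_inv \<mu> x)) \<longlongrightarrow> 1) at_top" if l: "l > 0" for l
    proof (rule Lim_transform_eventually)
      show "((\<lambda>x. phi (l * x) / phi x) \<longlongrightarrow> 1) at_top"
        using slow l by (simp add: varies_slowly_def)
      show "\<forall>\<^sub>F x in at_top. phi (l * x) / phi x = (1 / f_inv \<mu> (l * x)) / (1 / f_inv \<mu> x)"
        using eq[OF l] eq1 by eventually_elim simp
    qed
    then show "(\<lambda>x. 1 / f_inv \<mu> x) \<in> slowly_varying"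
      unfolding slowly_varying_def using inverse_f_inv_pos_measurable by blast
    show "((\<lambda>x. tail x / (1 / f_inv \<mu> x)) \<longlongrightarrow> 1) at_top"
    proof (rule Lim_transform_eventually[OF tail_asymp_phi[OF slow]])
      show "\<forall>\<^sub>F x in at_top. tail x / phi x = tail x / (1 / f_inv \<mu> x)"
        using eq1 by eventually_elim simp
    qed
  qed
  ultimately show ?thesis using f_fun_eq_S_transform by blast
qed

end
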